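(* Let $\mathsf{DB}$ be a database over a first-order signature without function symbols, and let $$p_1,\ldots,p_m,\mathsf{not}(p_{m+1}),\ldots,\mathsf{not}(p_\ell)\Longrightarrow\alpha_1\mid\cdots\mid\alpha_k$$ be an active integrity constraint (AIC) over $\mathsf{DB}$. Then $$(1:p_1),\ldots,(1:p_m),\mathsf{not}(1:p_{m+1}),\ldots,\mathsf{not}(1:p_\ell)\Longrightarrow(1:\alpha_1)\mid\cdots\mid(1:\alpha_k)$$ is a valid AIC over the multi-context system $M(\mathsf{DB})$ (valid with respect to $M(\mathsf{DB})$).
   Context: Database AICs. Let $\Sigma$ be a first-order signature without function symbols. A database is a set of ground atoms over $\Sigma$. A (ground) update action is an expression $+a$ or $-a$ with $a$ a ground atom. An AIC over a database is a rule $p_1,\ldots,p_m,\mathsf{not}(p_{m+1}),\ldots,\mathsf{not}(p_\ell)\Longrightarrow\alpha_1\mid\cdots\mid\alpha_k$ ($k\ge1$) where each $p_i$ is an atom over $\Sigma$, every variable free in $p_{m+1},\ldots,p_\ell$ occurs in $p_1,\ldots,p_m$, and each $\alpha_i$ is either $-p_j$ for some $1\le j\le m$ or $+p_j$ for some $m<j\le\ell$. The multi-context system $M(\mathsf{DB})$. It has a single context (numbered 1), over first-order logic, without bridge rules. Its knowledge bases are databases (sets of ground atoms over $\Sigma$) and its current knowledge base is $\mathsf{DB}$. Its management function allows addition ($+$) and removal ($-$) of facts: applying a set of actions (not containing both $+a$ and $-a$ for any $a$) to a knowledge base adds all atoms $a$ with $+a$ in the set and removes all atoms $a$ with $-a$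 in the set. The only acceptable belief set for a knowledge base $D$ is the set of literals true in $D$, i.e. all ground atoms in $D$ and the negations of all ground atoms not in $D$. Hence each system of this form has exactly one equilibrium, namely this belief set, and is logically consistent (it has an equilibrium). Satisfaction. The system with knowledge base $D$ satisfies a ground AIC $r$ with body $(1:p_1),\ldots,(1:p_m),\mathsf{not}(1:p_{m+1}),\ldots,\mathsf{not}(1:p_\ell)$, written $M'\models r$, if its unique equilibrium $S$ does not satisfy both $p_i\in S$ for all $i\le m$ and $p_i\notin S$ for all $m<i\le\ell$; i.e. if $p_i\notin D$ for some $i\le m$ or $p_i\in D$ for some $m<i\le\ell$. Updates and variants. For a finite set $\mathcal U$ of update actions, $\mathcal U(M)$ is the system obtained from $M$ by replacing the knowledge base by the result of applying $\mathcal U$ to it; for a single action, $\alpha(M)=\{\alpha\}(M)$. $\mathsf{vrt}(M)=\{\mathcal U(M)\mid\mathcal U\text{ a finite set of update actions over }M\}$. Validity. A ground AIC $r$ with set of head actions $\mathrm{head}(r)$ is valid w.r.t. $M$ if (1) for every logically consistent $M'\in\mathsf{vrt}(M)$ with $M'\not\models r$ there is $\mathcal U\subseteq\mathrm{head}(r)$ with $\mathcal U(M')\models r$; and (2) for every $\alpha\in\mathrm{head}(r)$ there is $M'\in\mathsf{vrt}(M)$ with $M'\not\models r$ and $\alpha(M')\models r$. An AIC with variables stands for its ground instances and is valid if all of them are.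
   Formalization: Validity is claimed only for ground instances in which no atom occurs in the body both positively and under not (the whole AIC is valid if all its instances are such); otherwise, as for p, not(p) ⟹ -p, no system violates the rule and condition (2) of validity fails. *)

theory Defs
  imports Main
begin

section \<open>Managed multi-context systems\<close>

text \<open>
  Contexts are the entries of a list and are numbered from 1, so context \<open>i\<close> is entry \<open>i - 1\<close>.
  A bridge rule consists of an operation to be triggered and of positive and negated body
  elements \<open>(i : b)\<close>. The management function is deterministic and partial: \<open>None\<close> means that
  the set of operations cannot be applied to the knowledge base.
\<close>

datatype ('b, 'op) bridge_rule =
  Bridge_Rule (bridge_head: 'op) (bridge_pos: "(nat \<times> 'b) set") (bridge_neg: "(nat \<times> 'b) set")

record ('k, 'b, 'op) mcs_context =
  KBs :: "'k set"
  BSs :: "'b set set"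
  ACC :: "'k \<Rightarrow> 'b set set"
  KB :: 'k
  bridge_rules :: "('b, 'op) bridge_rule set"
  OPs :: "'op set"
  mng :: "'op set \<Rightarrow> 'k \<Rightarrow> 'k option"

type_synonym ('k, 'b, 'op) mcs = "('k, 'b, 'op) mcs_context list"
type_synonym 'b belief_state = "'b set list"

definition wf_context :: "('k, 'b, 'op) mcs_context \<Rightarrow> bool" where
  "wf_context C \<longleftrightarrow>
     KB C \<in> KBs C \<and>
     (\<forall>k\<in>KBs C. ACC C k \<subseteq> BSs C) \<and>
     bridge_head ` bridge_rules C \<subseteq> OPs C \<and>
     (\<forall>ops k k'. ops \<subseteq> OPs C \<and> k \<in> KBs C \<and> mng C ops k = Some k' \<longrightarrow> k' \<in> KBs C)"

definition holds :: "'b belief_state \<Rightarrow> nat \<times> 'b \<Rightarrow> bool" where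
  "holds S x \<longleftrightarrow> 1 \<le> fst x \<and> fst x \<le> length S \<and> snd x \<in> S ! (fst x - 1)"

definition app :: "('k, 'b, 'op) mcs_context \<Rightarrow> 'b belief_state \<Rightarrow> 'op set" where
  "app C S = {bridge_head \<rho> | \<rho>. \<rho> \<in> bridge_rules C \<and>
                (\<forall>x\<in>bridge_pos \<rho>. holds S x) \<and> (\<forall>x\<in>bridge_neg \<rho>. \<not> holds S x)}"

definition equilibrium :: "('k, 'b, 'op) mcs \<Rightarrow> 'b belief_state \<Rightarrow> bool" where
  "equilibrium M S \<longleftrightarrow> length S = length M \<and>
     (\<forall>j<length M. \<exists>k. mng (M ! j) (app (M ! j) S) (KB (M ! j)) = Some k \<and> S ! j \<in> ACC (M ! j) k)"

definition logically_consistent :: "('k, 'b, 'op) mcs \<Rightarrow> bool" where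
  "logically_consistent M \<longleftrightarrow> (\<exists>S. equilibrium M S)"

text \<open>An update action \<open>(i : \<alpha>)\<close> applies the operation \<open>\<alpha>\<close> in context \<open>i\<close>.\<close>

definition update_actions :: "('k, 'b, 'op) mcs \<Rightarrow> (nat \<times> 'op) set" where
  "update_actions M = {(i, \<alpha>). 1 \<le> i \<and> i \<le> length M \<and> \<alpha> \<in> OPs (M ! (i - 1))}"

definition updated_kb :: "(nat \<times> 'op) set \<Rightarrow> ('k, 'b, 'op) mcs \<Rightarrow> nat \<Rightarrow> 'k option" where
  "updated_kb U M j = mng (M ! j) {\<alpha>. (Suc j, \<alpha>) \<in> U} (KB (M ! j))"

text \<open>\<open>is_update U M M'\<close> expresses that \<open>U(M)\<close> is defined and equal to \<open>M'\<close>.\<close>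

definition is_update :: "(nat \<times> 'op) set \<Rightarrow> ('k, 'b, 'op) mcs \<Rightarrow> ('k, 'b, 'op) mcs \<Rightarrow> bool" where
  "is_update U M M' \<longleftrightarrow> finite U \<and> U \<subseteq> update_actions M \<and> length M' = length M \<and>
     (\<forall>j<length M. \<exists>k. updated_kb U M j = Some k \<and> M' ! j = (M ! j)\<lparr>KB := k\<rparr>)"

definition vrt :: "('k, 'b, 'op) mcs \<Rightarrow> ('k, 'b, 'op) mcs set" where
  "vrt M = {M'. \<exists>U. is_update U M M'}"

section \<open>Active integrity constraints\<close>

text \<open>
  \<open>AIC ps ns hs\<close> is the rule with positive body elements \<open>ps\<close>, negated body elements \<open>ns\<close> and
  head actions \<open>hs\<close>. The type is used both for rules over databases and for rules over
  multi-context systems, with and without variables.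
\<close>

datatype ('x, 'y) aic = AIC (pos_body: "'x list") (neg_body: "'x list") (head: "'y list")

type_synonym ('b, 'op) mcs_aic = "(nat \<times> 'b, nat \<times> 'op) aic"

definition aic_over :: "('k, 'b, 'op) mcs \<Rightarrow> ('b, 'op) mcs_aic \<Rightarrow> bool" where
  "aic_over M r \<longleftrightarrow>
     (\<forall>(i, b)\<in>set (pos_body r) \<union> set (neg_body r). 1 \<le> i \<and> i \<le> length M \<and> b \<in> \<Union> (BSs (M ! (i - 1)))) \<and>
     head r \<noteq> [] \<and> set (head r) \<subseteq> update_actions M"

definition body_holds :: "'b belief_state \<Rightarrow> ('b, 'op) mcs_aic \<Rightarrow> bool" where
  "body_holds S r \<longleftrightarrow>
     (\<forall>x\<in>set (pos_body r). holds S x) \<and> (\<forall>x\<in>set (neg_body r). \<not> holds S x)"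

text \<open>Satisfaction refers to the unique equilibrium; it is meant for systems that have exactly one.\<close>

definition satisfies :: "('k, 'b, 'op) mcs \<Rightarrow> ('b, 'op) mcs_aic \<Rightarrow> bool" where
  "satisfies M r \<longleftrightarrow> (\<exists>S. {S'. equilibrium M S'} = {S} \<and> \<not> body_holds S r)"

definition valid_ground_aic :: "('k, 'b, 'op) mcs \<Rightarrow> ('b, 'op) mcs_aic \<Rightarrow> bool" where
  "valid_ground_aic M r \<longleftrightarrow>
     (\<forall>M'\<in>vrt M. logically_consistent M' \<and> \<not> satisfies M' r \<longrightarrow>
        (\<exists>U M''. U \<subseteq> set (head r) \<and> is_update U M' M'' \<and> satisfies M'' r)) \<and>
     (\<forall>\<alpha>\<in>set (head r). \<exists>M'\<in>vrt M. \<not> satisfies M' r \<and>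
        (\<exists>M''. is_update {\<alpha>} M' M'' \<and> satisfies M'' r))"

section \<open>Databases and their constraints\<close>

text \<open>Function-free signatures still contain constants.\<close>

record ('p, 'c) signature =
  preds :: "'p set"
  arity :: "'p \<Rightarrow> nat"
  constants :: "'c set"

datatype ('c, 'v) trm = Const 'c | Var 'v

datatype ('p, 't) atom = Atom 'p "'t list"

datatype 'a action = Add 'a | Del 'a

datatype 'a literal = Pos 'a | Neg 'a

type_synonym ('p, 'c) ground_atom = "('p, 'c) atom"
type_synonym ('p, 'c, 'v) open_atom = "('p, ('c, 'v) trm) atom"
type_synonym ('p, 'c, 'v) db_aic = "(('p, 'c, 'v) open_atom, ('p, 'c, 'v) open_atom action) aic"

definition ground_atoms :: "('p, 'c) signature \<Rightarrow> ('p, 'c) ground_atom set" where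
  "ground_atoms \<Sigma> = {Atom p cs | p cs. p \<in> preds \<Sigma> \<and> length cs = arity \<Sigma> p \<and> set cs \<subseteq> constants \<Sigma>}"

definition open_atoms :: "('p, 'c) signature \<Rightarrow> ('p, 'c, 'v) open_atom set" where
  "open_atoms \<Sigma> = {Atom p ts | p ts. p \<in> preds \<Sigma> \<and> length ts = arity \<Sigma> p \<and>
                                     (\<forall>c. Const c \<in> set ts \<longrightarrow> c \<in> constants \<Sigma>)}"

definition vars :: "('p, 'c, 'v) open_atom \<Rightarrow> 'v set" where
  "vars a = {v. Var v \<in> set2_atom a}"

definition databases :: "('p, 'c) signature \<Rightarrow> ('p, 'c) ground_atom set set" where
  "databases \<Sigma> = Pow (ground_atoms \<Sigma>)"

definition wf_db_aic :: "('p, 'c) signature \<Rightarrow> ('p, 'c, 'v) db_aic \<Rightarrow> bool" where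
  "wf_db_aic \<Sigma> r \<longleftrightarrow>
     set (pos_body r) \<union> set (neg_body r) \<subseteq> open_atoms \<Sigma> \<and>
     (\<Union>a\<in>set (neg_body r). vars a) \<subseteq> (\<Union>a\<in>set (pos_body r). vars a) \<and>
     head r \<noteq> [] \<and>
     set (head r) \<subseteq> Del ` set (pos_body r) \<union> Add ` set (neg_body r)"

definition db_mng :: "'a action set \<Rightarrow> 'a set \<Rightarrow> 'a set option" where
  "db_mng U D = (if \<exists>a. Add a \<in> U \<and> Del a \<in> U then None
                 else Some ((D \<union> {a. Add a \<in> U}) - {a. Del a \<in> U}))"

definition true_literals :: "('p, 'c) signature \<Rightarrow> ('p, 'c) ground_atom set
    \<Rightarrow> ('p, 'c) ground_atom literal set" where
  "true_literals \<Sigma> D = Pos ` D \<union> Neg ` (ground_atoms \<Sigma> - D)"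

definition db_context :: "('p, 'c) signature \<Rightarrow> ('p, 'c) ground_atom set \<Rightarrow>
    (('p, 'c) ground_atom set, ('p, 'c) ground_atom literal, ('p, 'c) ground_atom action) mcs_context" where
  "db_context \<Sigma> DB =
     \<lparr>KBs = databases \<Sigma>,
      BSs = Pow (Pos ` ground_atoms \<Sigma> \<union> Neg ` ground_atoms \<Sigma>),
      ACC = (\<lambda>D. {true_literals \<Sigma> D}),
      KB = DB,
      bridge_rules = {},
      OPs = Add ` ground_atoms \<Sigma> \<union> Del ` ground_atoms \<Sigma>,
      mng = db_mng\<rparr>"

text \<open>This is \<open>M(DB)\<close>.\<close>

definition db_mcs :: "('p, 'c) signature \<Rightarrow> ('p, 'c) ground_atom set \<Rightarrow>
    (('p, 'c) ground_atom set, ('p, 'c) ground_atom literal, ('p, 'c) ground_atom action) mcs" where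
  "db_mcs \<Sigma> DB = [db_context \<Sigma> DB]"

text \<open>Replace each atom \<open>p\<close> in the body by \<open>(1 : p)\<close> and each head action \<open>\<alpha>\<close> by \<open>(1 : \<alpha>)\<close>.\<close>

definition to_mcs_aic :: "('p, 'c, 'v) db_aic \<Rightarrow>
    (('p, 'c, 'v) open_atom literal, ('p, 'c, 'v) open_atom action) mcs_aic" where
  "to_mcs_aic r = map_aic (\<lambda>a. (1, Pos a)) (\<lambda>\<alpha>. (1, \<alpha>)) r"

section \<open>Ground instances\<close>

primrec subst_trm :: "('v \<Rightarrow> 'c) \<Rightarrow> ('c, 'v) trm \<Rightarrow> 'c" where
  "subst_trm \<sigma> (Const c) = c"
| "subst_trm \<sigma> (Var v) = \<sigma> v"

definition subst_atom :: "('v \<Rightarrow> 'c) \<Rightarrow> ('p, 'c, 'v) open_atom \<Rightarrow> ('p, 'c) ground_atom" where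
  "subst_atom \<sigma> = map_atom id (subst_trm \<sigma>)"

definition subst_aic :: "('v \<Rightarrow> 'c) \<Rightarrow>
    (('p, 'c, 'v) open_atom literal, ('p, 'c, 'v) open_atom action) mcs_aic \<Rightarrow>
    (('p, 'c) ground_atom literal, ('p, 'c) ground_atom action) mcs_aic" where
  "subst_aic \<sigma> =
     map_aic (map_prod id (map_literal (subst_atom \<sigma>))) (map_prod id (map_action (subst_atom \<sigma>)))"

definition aic_vars ::
    "(('p, 'c, 'v) open_atom literal, ('p, 'c, 'v) open_atom action) mcs_aic \<Rightarrow> 'v set" where
  "aic_vars r =
     (\<Union>x\<in>set (pos_body r) \<union> set (neg_body r). \<Union> (vars ` set_literal (snd x))) \<union>
     (\<Union>x\<in>set (head r). \<Union> (vars ` set_action (snd x)))"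

text \<open>
  Only the variables that occur in the rule must be mapped to constants of the signature, so a
  rule without variables has itself as an instance even if the signature has no constants.
\<close>

definition ground_instances :: "('p, 'c) signature \<Rightarrow>
    (('p, 'c, 'v) open_atom literal, ('p, 'c, 'v) open_atom action) mcs_aic \<Rightarrow>
    (('p, 'c) ground_atom literal, ('p, 'c) ground_atom action) mcs_aic set" where
  "ground_instances \<Sigma> r = {subst_aic \<sigma> r | \<sigma>. \<sigma> ` aic_vars r \<subseteq> constants \<Sigma>}"

definition valid_aic :: "('p, 'c) signature \<Rightarrow>
    ('k, ('p, 'c) ground_atom literal, ('p, 'c) ground_atom action) mcs \<Rightarrow>
    (('p, 'c, 'v) open_atom literal, ('p, 'c, 'v) open_atom action) mcs_aic \<Rightarrow> bool" where
  "valid_aic \<Sigma> M r \<longleftrightarrow> (\<forall>g\<in>ground_instances \<Sigma> r. valid_ground_aic M g)"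

text \<open>
  A ground body is inconsistent if some element occurs in it both positively and negated. Such a
  body can arise by grounding, e.g. from \<open>e(X,Y), not e(Y,X) \<Longrightarrow> +e(Y,X)\<close> with \<open>X = Y\<close>.
  No system violates a rule with such a body, so the second condition of validity fails for it
  (see \<open>not_valid_if_body_inconsistent\<close> below).
\<close>

definition body_consistent :: "('b, 'op) mcs_aic \<Rightarrow> bool" where
  "body_consistent r \<longleftrightarrow> set (pos_body r) \<inter> set (neg_body r) = {}"

section \<open>Sanity checks\<close>

lemma wf_context_db_context: "DB \<in> databases \<Sigma> \<Longrightarrow> wf_context (db_context \<Sigma> DB)"
  by (auto simp: wf_context_def db_context_def databases_def true_literals_def db_mng_def
           split: if_splits)

lemma equilibrium_db_mcs: "equilibrium (db_mcs \<Sigma> DB) S \<longleftrightarrow> S = [true_literals \<Sigma> DB]"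
proof (cases S)
  case Nil
  then show ?thesis by (simp add: equilibrium_def db_mcs_def)
next
  case (Cons B S')
  have "app (db_context \<Sigma> DB) S = {}" by (simp add: app_def db_context_def)
  moreover have "mng (db_context \<Sigma> DB) {} (KB (db_context \<Sigma> DB)) = Some DB"
    "ACC (db_context \<Sigma> DB) DB = {true_literals \<Sigma> DB}"
    by (simp_all add: db_context_def db_mng_def)
  ultimately show ?thesis using Cons by (auto simp: equilibrium_def db_mcs_def)
qed

lemma satisfies_db_mcs:
  "satisfies (db_mcs \<Sigma> DB) g \<longleftrightarrow> \<not> body_holds [true_literals \<Sigma> DB] g"
  by (auto simp: satisfies_def equilibrium_db_mcs)

lemma is_update_db_mcs:
  "is_update U (db_mcs \<Sigma> DB) M' \<longleftrightarrow> finite U \<and> U \<subseteq> update_actions (db_mcs \<Sigma> DB) \<and>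
     (\<exists>D. db_mng {\<alpha>. (1, \<alpha>) \<in> U} DB = Some D \<and> M' = db_mcs \<Sigma> D)"
proof -
  have [simp]: "(db_context \<Sigma> DB)\<lparr>KB := D\<rparr> = db_context \<Sigma> D"
    "mng (db_context \<Sigma> DB) = db_mng" "KB (db_context \<Sigma> DB) = DB" for D
    by (simp_all add: db_context_def)
  show ?thesis
    unfolding is_update_def updated_kb_def db_mcs_def
    by (cases M') auto
qed

lemma not_valid_if_body_inconsistent:
  assumes "\<not> body_consistent g" "head g \<noteq> []"
  shows "\<not> valid_ground_aic (db_mcs \<Sigma> DB) g"
proof
  assume v: "valid_ground_aic (db_mcs \<Sigma> DB) g"
  obtain \<alpha> where "\<alpha> \<in> set (head g)" using assms(2) by (meson last_in_set)
  with v obtain M' where "M' \<in> vrt (db_mcs \<Sigma> DB)" and n: "\<not> satisfies M' g"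
    unfolding valid_ground_aic_def by blast
  then obtain D where "M' = db_mcs \<Sigma> D" by (auto simp: vrt_def is_update_db_mcs)
  with n have "body_holds [true_literals \<Sigma> D] g" by (simp add: satisfies_db_mcs)
  with assms(1) show False by (auto simp: body_holds_def body_consistent_def)
qed

end

theory Submission
  imports Defs
begin

text \<open>
  If the body of a ground instance is consistent, adding its positive atoms to any database and
  removing its negated ones yields a database that violates the instance. Each head action
  falsifies one body literal, so in any violating database a single head action restores
  satisfaction; both conditions of validity follow.
\<close>

lemma subst_atom_in_ground_atoms:
  assumes "a \<in> open_atoms \<Sigma>" "\<sigma> ` vars a \<subseteq> constants \<Sigma>"
  shows "subst_atom \<sigma> a \<in> ground_atoms \<Sigma>"
proof -
  obtain p ts where a: "a = Atom p ts" "p \<in> preds \<Sigma>" "length ts = arity \<Sigma> p"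
    and c: "\<And>c. Const c \<in> set ts \<Longrightarrow> c \<in> constants \<Sigma>"
    using assms(1) by (auto simp: open_atoms_def)
  have "subst_trm \<sigma> t \<in> constants \<Sigma>" if "t \<in> set ts" for t
    using assms(2) that c by (cases t) (auto simp: a(1) vars_def)
  then show ?thesis using a by (auto simp: subst_atom_def ground_atoms_def)
qed

lemma subst_aic_to_mcs_aic:
  "subst_aic \<sigma> (to_mcs_aic r) =
     AIC (map (\<lambda>a. (1, Pos (subst_atom \<sigma> a))) (pos_body r))
         (map (\<lambda>a. (1, Pos (subst_atom \<sigma> a))) (neg_body r))
         (map (\<lambda>\<alpha>. (1, map_action (subst_atom \<sigma>) \<alpha>)) (head r))"
  by (cases r) (simp add: subst_aic_def to_mcs_aic_def comp_def)

text \<open>\<open>ground_instances\<close> constrains \<sigma> on the variables of the whole rule;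
  this passes the constraint on to single body atoms.\<close>

lemma vars_subset_aic_vars:
  "a \<in> set (pos_body r) \<union> set (neg_body r) \<Longrightarrow> vars a \<subseteq> aic_vars (to_mcs_aic r)"
  by (cases r) (auto simp: aic_vars_def to_mcs_aic_def)

lemma update_actions_db_mcs:
  "update_actions (db_mcs \<Sigma> D) = Pair 1 ` (Add ` ground_atoms \<Sigma> \<union> Del ` ground_atoms \<Sigma>)"
  by (auto simp: update_actions_def db_mcs_def db_context_def)

text \<open>Body elements are all of the form \<open>Pos a\<close>, negation being expressed by
  \<open>neg_body\<close>, and \<open>Pos a\<close> lies in \<open>true_literals \<Sigma> D\<close>
  exactly when \<open>a\<close> lies in \<open>D\<close>. Satisfaction thus becomes a condition on
  sets of atoms.\<close>

lemma satisfies_db_mcs_iff: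
  assumes "set (pos_body g) = (\<lambda>a. (1, Pos a)) ` A" "set (neg_body g) = (\<lambda>a. (1, Pos a)) ` B"
  shows "satisfies (db_mcs \<Sigma> D) g \<longleftrightarrow> \<not> (A \<subseteq> D \<and> B \<inter> D = {})"
  using assms by (auto simp: satisfies_db_mcs body_holds_def holds_def true_literals_def)

lemma valid_ground_aic_db_mcs:
  assumes pos: "set (pos_body g) = (\<lambda>a. (1, Pos a)) ` A"
    and neg: "set (neg_body g) = (\<lambda>a. (1, Pos a)) ` B"
    and hd: "set (head g) \<subseteq> Pair 1 ` (Del ` A \<union> Add ` B)" "head g \<noteq> []"
    and fin: "finite A" "finite B"
    and ground: "A \<union> B \<subseteq> ground_atoms \<Sigma>"
    and disj: "A \<inter> B = {}"
  shows "valid_ground_aic (db_mcs \<Sigma> DB) g"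
proof -
  note sat = satisfies_db_mcs_iff[OF pos neg]
  \<comment> \<open>Stated for every \<open>D\<close>, violating or not, so that it serves both
    conditions of validity. A single action cannot conflict with itself, so the update is always
    defined.\<close>
  have repair: "\<exists>M''. is_update {\<alpha>} (db_mcs \<Sigma> D) M'' \<and> satisfies M'' g"
    if \<alpha>: "\<alpha> \<in> set (head g)" for \<alpha> D
  proof -
    from \<alpha> hd(1) consider a where "a \<in> A" "\<alpha> = (1, Del a)" | b where "b \<in> B" "\<alpha> = (1, Add b)"
      by blast
    then show ?thesis
    proof cases
      case 1
      then have "is_update {\<alpha>} (db_mcs \<Sigma> D) (db_mcs \<Sigma> (D - {a}))"
        using ground by (auto simp: is_update_db_mcs update_actions_db_mcs db_mng_def)
      moreover have "satisfies (db_mcs \<Sigma> (D - {a})) g" using 1 by (auto simp: sat)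
      ultimately show ?thesis by blast
    next
      case 2
      then have "is_update {\<alpha>} (db_mcs \<Sigma> D) (db_mcs \<Sigma> (insert b D))"
        using ground by (auto simp: is_update_db_mcs update_actions_db_mcs db_mng_def)
      moreover have "satisfies (db_mcs \<Sigma> (insert b D)) g" using 2 by (auto simp: sat)
      ultimately show ?thesis by blast
    qed
  qed
  \<comment> \<open>Variants arise from finite updates only, so the violating database is
    \<open>DB\<close> changed just at the finitely many body atoms.\<close>
  let ?U = "Pair 1 ` (Add ` A \<union> Del ` B)"
  let ?D = "DB \<union> A - B"
  have "{\<alpha>. (1, \<alpha>) \<in> ?U} = Add ` A \<union> Del ` B" by auto
  \<comment> \<open>Disjointness of \<open>A\<close> and \<open>B\<close> keeps
    \<open>db_mng\<close> from returning \<open>None\<close>: no atom is both added and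
    removed.\<close>
  moreover have "db_mng (Add ` A \<union> Del ` B) DB = Some ?D"
    using disj by (auto simp: db_mng_def)
  moreover have "finite ?U" using fin by simp
  moreover have "?U \<subseteq> update_actions (db_mcs \<Sigma> DB)"
    unfolding update_actions_db_mcs using ground by (intro image_mono) auto
  ultimately have "is_update ?U (db_mcs \<Sigma> DB) (db_mcs \<Sigma> ?D)"
    unfolding is_update_db_mcs by metis
  then have violated: "db_mcs \<Sigma> ?D \<in> vrt (db_mcs \<Sigma> DB)" "\<not> satisfies (db_mcs \<Sigma> ?D) g"
    using disj by (auto simp: vrt_def sat)
  show ?thesis
    unfolding valid_ground_aic_def
  proof (intro conjI ballI impI)
    fix M' assume "M' \<in> vrt (db_mcs \<Sigma> DB)"
    then obtain D where M': "M' = db_mcs \<Sigma> D" by (auto simp: vrt_def is_update_db_mcs)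
    from hd(2) obtain \<alpha> where \<alpha>: "\<alpha> \<in> set (head g)" by (meson last_in_set)
    with repair[OF \<alpha>, of D] show "\<exists>U M''. U \<subseteq> set (head g) \<and> is_update U M' M'' \<and> satisfies M'' g"
      unfolding M' by (meson empty_subsetI insert_subset)
  next
    fix \<alpha> assume "\<alpha> \<in> set (head g)"
    with violated repair show "\<exists>M'\<in>vrt (db_mcs \<Sigma> DB). \<not> satisfies M' g \<and>
        (\<exists>M''. is_update {\<alpha>} M' M'' \<and> satisfies M'' g)" by blast
  qed
qed

text \<open>Validity is claimed for instances with consistent bodies, since distinct atoms may
  coincide after grounding. For all other instances it fails by
  \<open>not_valid_if_body_inconsistent\<close>, as heads are nonempty.\<close>

theorem proposition2:
  fixes \<Sigma> :: "('p, 'c) signature"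
    and DB :: "('p, 'c) ground_atom set"
    and r :: "('p, 'c, 'v) db_aic"
  assumes "DB \<in> databases \<Sigma>"
    and "wf_db_aic \<Sigma> r"
  shows "(\<forall>g\<in>ground_instances \<Sigma> (to_mcs_aic r).
            aic_over (db_mcs \<Sigma> DB) g \<and>
            (body_consistent g \<longrightarrow> valid_ground_aic (db_mcs \<Sigma> DB) g)) \<and>
         ((\<forall>g\<in>ground_instances \<Sigma> (to_mcs_aic r). body_consistent g) \<longrightarrow>
            valid_aic \<Sigma> (db_mcs \<Sigma> DB) (to_mcs_aic r))"
proof -
  have "aic_over (db_mcs \<Sigma> DB) g \<and> (body_consistent g \<longrightarrow> valid_ground_aic (db_mcs \<Sigma> DB) g)"
    if "g \<in> ground_instances \<Sigma> (to_mcs_aic r)" for g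
  proof -
    from that obtain \<sigma> where g: "g = subst_aic \<sigma> (to_mcs_aic r)"
      and \<sigma>: "\<sigma> ` aic_vars (to_mcs_aic r) \<subseteq> constants \<Sigma>"
      by (auto simp: ground_instances_def)
    define A where "A = subst_atom \<sigma> ` set (pos_body r)"
    define B where "B = subst_atom \<sigma> ` set (neg_body r)"
    have pos: "set (pos_body g) = (\<lambda>a. (1, Pos a)) ` A"
      and neg: "set (neg_body g) = (\<lambda>a. (1, Pos a)) ` B"
      by (auto simp: g subst_aic_to_mcs_aic A_def B_def)
    \<comment> \<open>Head actions are built from body atoms, so this also places the head of
      \<open>g\<close> among the update actions.\<close>
    have ground: "A \<union> B \<subseteq> ground_atoms \<Sigma>"
    proof -
      have "subst_atom \<sigma> a \<in> ground_atoms \<Sigma>" if "a \<in> set (pos_body r) \<union> set (neg_body r)" for a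
      proof (rule subst_atom_in_ground_atoms)
        show "a \<in> open_atoms \<Sigma>" using that assms(2) unfolding wf_db_aic_def by blast
        show "\<sigma> ` vars a \<subseteq> constants \<Sigma>" using vars_subset_aic_vars[OF that] \<sigma> by blast
      qed
      then show ?thesis by (auto simp: A_def B_def)
    qed
    have ne: "head g \<noteq> []"
      using assms(2) by (simp add: g subst_aic_to_mcs_aic wf_db_aic_def)
    have "set (head r) \<subseteq> Del ` set (pos_body r) \<union> Add ` set (neg_body r)"
      using assms(2) by (simp add: wf_db_aic_def)
    then have hd: "set (head g) \<subseteq> Pair 1 ` (Del ` A \<union> Add ` B)"
      by (fastforce simp: g subst_aic_to_mcs_aic A_def B_def)
    have "set (head g) \<subseteq> update_actions (db_mcs \<Sigma> DB)"
      unfolding update_actions_db_mcs using ground by (intro order_trans[OF hd] image_mono) auto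
    \<comment> \<open>\<open>BSs\<close> is a full power set, so even the singleton
      \<open>{Pos a}\<close> is a possible belief set, although it need not be acceptable for any
      database.\<close>
    moreover have "\<exists>X\<in>BSs (db_context \<Sigma> DB). Pos a \<in> X" if "a \<in> A \<union> B" for a
      using that ground by (intro bexI[of _ "{Pos a}"]) (auto simp: db_context_def)
    ultimately have "aic_over (db_mcs \<Sigma> DB) g"
      using ne by (auto simp: aic_over_def pos neg db_mcs_def)
    moreover have "valid_ground_aic (db_mcs \<Sigma> DB) g" if "body_consistent g"
    proof (rule valid_ground_aic_db_mcs[OF pos neg hd ne _ _ ground])
      show "finite A" "finite B" by (simp_all add: A_def B_def)
      show "A \<inter> B = {}" using that by (auto simp: body_consistent_def pos neg)
    qed
    ultimately show ?thesis by blast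
  qed
  then show ?thesis by (simp add: valid_aic_def)
qed

end
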